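(* For any integer $a$, the number of positive integers $n\le x$ with $\sigma(n)\equiv a \pmod n$ is $O(x/\log x)$, uniformly in $a$. That is, there is an absolute constant $K$ such that for every integer $a$ and every real $x\ge 2$, one has $\#\{n\le x : \sigma(n)\equiv a \pmod n\}\le K x/\log x$.
   Context: $\sigma(n)$ denotes the sum of all positive divisors of the positive integer $n$. *)

theory Defs
  imports Complex_Main "HOL-Number_Theory.Cong"
begin

(* Meant for n > 0: every natural number divides 0, so divisor_sigma 0 is a sum over an infinite set. *)
definition divisor_sigma :: "nat \<Rightarrow> nat" where
  "divisor_sigma n = (\<Sum>d | d dvd n. d)"

end

theory Submission
  imports
    Defs
    "HOL-Analysis.Harmonic_Numbers"
    "HOL-Computational_Algebra.Squarefree"
    "HOL-Real_Asymp.Real_Asymp"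
begin

text \<open>
  Put \<open>L = ln N\<close>. All but \<open>O(N / L\<^sup>2)\<close> of the \<open>n \<le> N\<close> have the form \<open>n = m q\<close> with a prime
  \<open>q > L\<^sup>8\<close> not dividing \<open>m\<close>, so that \<open>\<sigma>(n) = (q + 1) \<sigma>(m)\<close>. Such a factorisation of \<open>m\<close> also shows that
  the fibres of \<open>\<sigma>\<close> up to \<open>N\<close>, and the set of \<open>m \<le> N\<close> with \<open>gcd(m, \<sigma>(m)) \<ge> m / L\<^sup>2\<close>, have only
  \<open>O(N / L\<^sup>2)\<close> elements, because \<open>m / q\<close> determines \<open>q\<close> up to at most \<open>L\<^sup>4 (1 + L)\<close> choices.

  Now let \<open>n = m q > N / L\<close>. If \<open>m \<le> N\<^bsup>1/4\<^esup>\<close> then \<open>q > \<surd>N \<ge> \<sigma>(m)\<close>, and reducing the congruence modulo \<open>q\<close> shows that \<open>\<sigma>(m)\<close> is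
  the residue of \<open>a\<close> modulo \<open>q\<close>; hence for given \<open>q\<close> the number \<open>m\<close> lies in a fibre of \<open>\<sigma>\<close>, and a
  dyadic decomposition in \<open>m\<close> together with Chebyshev's bound for the number of primes gives
  \<open>O(N / L)\<close>. If \<open>m > N\<^bsup>1/4\<^esup>\<close>, reducing modulo \<open>m\<close> puts \<open>q\<close> in a residue class modulo
  \<open>m / gcd(m, \<sigma>(m))\<close>, which leaves at most \<open>1 + N gcd(m, \<sigma>(m)) / m\<^sup>2\<close> values for \<open>q\<close>. Since
  \<open>m < N / L\<^sup>8\<close> and \<open>gcd(m, \<sigma>(m))\<close> is rarely large, these sum to \<open>O(N / L)\<close>.
\<close>

section \<open>Elementary sums and counts of multiples\<close>

lemma harm_le_Suc_ln:
  assumes "N \<ge> 1"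
  shows "harm N \<le> 1 + ln (real N)"
proof -
  have "harm N - ln (of_nat N) \<le> harm 1 - ln (of_nat 1 :: real)"
    using assms by (intro euler_mascheroni_sequence_decreasing) auto
  then show ?thesis
    by (simp add: harm_def)
qed

text \<open>The subtracted term on the right makes the induction telescope.\<close>

lemma sum_inverse_squares_le:
  "(\<Sum>j\<le>n. 1 / (real j + 1)\<^sup>2) \<le> 2 - 1 / (real n + 1)"
proof (induction n)
  case (Suc n)
  have "1 / (real (Suc n) + 1)\<^sup>2 \<le> 1 / (real n + 1) - 1 / (real (Suc n) + 1)"
    by (simp add: divide_simps power2_eq_square)
  with Suc show ?case by simp
qed auto

lemma sum_inverse_squares_tail_le:
  assumes "k \<ge> 1"
  shows "(\<Sum>s\<in>{k<..n}. 1 / (real s)\<^sup>2) \<le> 1 / real k"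
proof -
  have "(\<Sum>s\<in>{k<..k+i}. 1 / (real s)\<^sup>2) \<le> 1 / real k - 1 / real (k + i)" for i
  proof (induction i)
    case (Suc i)
    have "{k<..k + Suc i} = insert (k + Suc i) {k<..k+i}" by auto
    moreover have "1 / (real (k + Suc i))\<^sup>2 \<le> 1 / real (k + i) - 1 / real (k + Suc i)"
      using assms by (simp add: divide_simps power2_eq_square)
    ultimately show ?case using Suc by simp
  qed auto
  from this[of "n - k"] show ?thesis
    by (cases "k \<le> n") (auto intro: order_trans)
qed

lemma card_multiples: "d > 0 \<Longrightarrow> card {m\<in>{1..N::nat}. d dvd m} = N div d"
proof -
  assume "d > 0"
  have "{m\<in>{1..N}. d dvd m} = (\<lambda>k. d * k) ` {1..N div d}"
  proof (intro equalityI subsetI)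
    fix m assume "m \<in> {m\<in>{1..N}. d dvd m}"
    then obtain k where k: "m = d * k" "1 \<le> m" "m \<le> N" by auto
    then have "k \<le> N div d" using \<open>d > 0\<close>
      by (simp add: less_eq_div_iff_mult_less_eq mult.commute)
    moreover have "k \<ge> 1" using k by (cases k) auto
    ultimately show "m \<in> (\<lambda>k. d * k) ` {1..N div d}" using k by auto
  next
    fix m assume "m \<in> (\<lambda>k. d * k) ` {1..N div d}"
    then show "m \<in> {m\<in>{1..N}. d dvd m}" using \<open>d > 0\<close>
      by (auto simp: less_eq_div_iff_mult_less_eq mult.commute)
  qed
  moreover have "inj_on (\<lambda>k. d * k) {1..N div d}" using \<open>d > 0\<close> by (auto intro: inj_onI)
  ultimately show ?thesis by (simp add: card_image)
qed

text \<open>Counting the pairs \<open>d dvd m\<close> by \<open>d\<close> first gives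
  \<open>N div d\<close> values of \<open>m\<close> for each \<open>d\<close>, hence a harmonic
  sum.\<close>

lemma sum_divisor_count_le:
  assumes "N \<ge> 1"
  shows "(\<Sum>m\<in>{1..N}. real (card {d. d dvd m})) \<le> real N * (1 + ln (real N))"
proof -
  have "(\<Sum>m\<in>{1..N}. card {d. d dvd m}) = (\<Sum>m\<in>{1..N}. card {d\<in>{1..N}. d dvd m})"
    by (intro sum.cong refl arg_cong[where f = card]) (force dest: dvd_imp_le intro: Nat.gr0I)
  also have "\<dots> = (\<Sum>d\<in>{1..N}. card {m\<in>{1..N}. d dvd m})"
    by (rule sum_multicount_gen) auto
  also have "\<dots> = (\<Sum>d\<in>{1..N}. N div d)"
    by (intro sum.cong refl card_multiples) auto
  finally have "(\<Sum>m\<in>{1..N}. real (card {d. d dvd m})) = (\<Sum>d\<in>{1..N}. real (N div d))"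
    by (metis (mono_tags) of_nat_sum)
  also have "\<dots> \<le> (\<Sum>d\<in>{1..N}. real N * inverse (real d))"
    by (intro sum_mono) (metis divide_inverse of_nat_div_le_of_nat)
  also have "\<dots> = real N * harm N" by (simp add: harm_def sum_distrib_left)
  also have "\<dots> \<le> real N * (1 + ln (real N))"
    using harm_le_Suc_ln[OF assms] by (intro mult_left_mono) auto
  finally show ?thesis .
qed

section \<open>The sum-of-divisors function\<close>

lemma divisor_sigma_pos: "n > 0 \<Longrightarrow> divisor_sigma n > 0"
  unfolding divisor_sigma_def by (rule sum_pos2[of _ n]) auto

lemma divisor_sigma_le:
  assumes "n > 0"
  shows "real (divisor_sigma n) \<le> real n * (1 + ln (real n))"
proof -
  \<comment> \<open>The involution \<open>d \<mapsto> n div d\<close> turns \<sigma>(n) into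
    \<open>n\<close> times a sum of reciprocals.\<close>
  have "(\<Sum>d | d dvd n. d) = (\<Sum>d | d dvd n. n div d)"
    by (rule sum.reindex_bij_witness[of _ "\<lambda>d. n div d" "\<lambda>d. n div d"])
       (use assms in \<open>auto simp: div_dvd_iff_mult\<close>)
  then have "real (divisor_sigma n) = (\<Sum>d | d dvd n. real n * inverse (real d))"
    unfolding divisor_sigma_def by (simp add: real_of_nat_div divide_inverse)
  also have "\<dots> \<le> (\<Sum>d\<in>{1..n}. real n * inverse (real d))"
    using assms by (intro sum_mono2) (auto dest: dvd_imp_le intro: Nat.gr0I)
  also have "\<dots> = real n * harm n" by (simp add: harm_def sum_distrib_left)
  also have "\<dots> \<le> real n * (1 + ln (real n))"
    using harm_le_Suc_ln[of n] assms by (intro mult_left_mono) auto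
  finally show ?thesis .
qed

lemma divisor_sigma_le_square: "n > 0 \<Longrightarrow> divisor_sigma n \<le> n\<^sup>2"
proof -
  assume "n > 0"
  then have "(\<Sum>d | d dvd n. d) \<le> (\<Sum>d\<in>{1..n}. n)"
    by (intro order_trans[OF sum_mono2[of "{1..n}"] sum_mono]) (auto dest: dvd_imp_le intro: Nat.gr0I)
  then show ?thesis by (simp add: divisor_sigma_def power2_eq_square)
qed

text \<open>The divisors of \<open>k * q\<close> are those of \<open>k\<close> and their multiples
  by \<open>q\<close>, without overlap because \<open>q\<close> does not divide
  \<open>k\<close>.\<close>

lemma divisor_sigma_mult_prime:
  assumes q: "prime q" "\<not> q dvd k" and k: "k > 0"
  shows "divisor_sigma (k * q) = (q + 1) * divisor_sigma k"
proof -
  have eq: "{d. d dvd k * q} = {d. d dvd k} \<union> (\<lambda>d. d * q) ` {d. d dvd k}"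
  proof (intro equalityI subsetI)
    fix d assume "d \<in> {d. d dvd k * q}"
    then have d: "d dvd k * q" by simp
    show "d \<in> {d. d dvd k} \<union> (\<lambda>d. d * q) ` {d. d dvd k}"
    proof (cases "q dvd d")
      case True
      then obtain e where "d = e * q" by (metis dvd_def mult.commute)
      then show ?thesis using d q(1) by (auto simp: prime_gt_0_nat)
    next
      case False
      then have "coprime d q" using q(1) by (metis coprime_commute prime_imp_coprime)
      then show ?thesis using d by (simp add: coprime_dvd_mult_left_iff)
    qed
  qed auto
  have "divisor_sigma (k * q) = (\<Sum>d | d dvd k. d) + (\<Sum>d\<in>(\<lambda>d. d * q) ` {d. d dvd k}. d)"
    unfolding divisor_sigma_def eq
    by (rule sum.union_disjoint) (use k q in \<open>auto dest: dvd_trans[rotated]\<close>)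
  also have "(\<Sum>d\<in>(\<lambda>d. d * q) ` {d. d dvd k}. d) = (\<Sum>d | d dvd k. d * q)"
    by (subst sum.reindex) (use q in \<open>auto intro!: inj_onI simp: prime_gt_0_nat\<close>)
  also have "\<dots> = q * (\<Sum>d | d dvd k. d)" by (simp add: sum_distrib_left mult.commute)
  finally show ?thesis by (simp add: divisor_sigma_def algebra_simps)
qed

section \<open>Chebyshev's upper bound\<close>

lemma prod_primes_dvd:
  fixes n :: nat
  assumes "finite A" "\<And>p. p \<in> A \<Longrightarrow> prime p" "\<And>p. p \<in> A \<Longrightarrow> p dvd n"
  shows "\<Prod>A dvd n"
  using assms
proof (induction A rule: finite_induct)
  case (insert p A)
  have "coprime p (\<Prod>A)"
    using insert by (intro prod_coprime_right) (auto intro!: primes_coprime)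
  then show ?case using insert by (auto intro: divides_mult)
qed auto

text \<open>Erdos's argument: for \<open>n = 2 * m + 1\<close> the primes in (m + 1, n] all divide
  \<open>n choose m\<close>, which is at most \<open>4 ^ m\<close>, and those up to
  \<open>m + 1\<close> fall under the induction hypothesis. An even \<open>n > 2\<close> is not
  prime and adds no factor.\<close>

lemma primorial_le: "(\<Prod>p | prime p \<and> p \<le> n. p) \<le> 4 ^ (n::nat)"
proof (induction n rule: less_induct)
  case (less n)
  consider "n \<le> 2" | "n > 2" "even n" | "n > 2" "odd n" by linarith
  then show ?case
  proof cases
    case 1
    then consider "n = 0" | "n = 1" | "n = 2" by linarith
    then show ?thesis
    proof cases
      case 3
      have "{p::nat. prime p \<and> p \<le> 2} = {2}" by (auto dest: prime_ge_2_nat)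
      with 3 show ?thesis by simp
    next
      case 1
      then have "{p. prime p \<and> p \<le> n} = {}" by auto
      then show ?thesis by (simp only: prod.empty) simp
    next
      case 2
      then have "{p. prime p \<and> p \<le> n} = {}" by (auto dest: prime_ge_2_nat)
      then show ?thesis by (simp only: prod.empty) simp
    qed
  next
    case 2
    have "\<not> prime n" using 2 prime_odd_nat by blast
    then have "p \<le> n \<longleftrightarrow> p \<le> n - 1" if "prime p" for p
      using that by (cases "p = n") auto
    then have "{p. prime p \<and> p \<le> n} = {p. prime p \<and> p \<le> n - 1}" by blast
    then have "(\<Prod>p | prime p \<and> p \<le> n. p) \<le> 4 ^ (n - 1)"
      using less[of "n - 1"] 2 by simp
    also have "\<dots> \<le> 4 ^ n" by (intro power_increasing) auto
    finally show ?thesis .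
  next
    case 3
    then obtain m where m: "n = 2 * m + 1" by (auto elim: oddE)
    with 3 have "m \<ge> 1" by simp
    define A where "A = {p. prime p \<and> m + 1 < p \<and> p \<le> n}"
    have fin: "finite A" unfolding A_def by simp
    have "\<Prod>A dvd (n choose m)"
    proof -
      have "p dvd (n choose m)" if "p \<in> A" for p
      proof -
        have p: "prime p" "m + 1 < p" "p \<le> n" using that by (auto simp: A_def)
        have "fact m * fact (n - m) * (n choose m) = fact n"
          using m by (intro binomial_fact_lemma) auto
        moreover have "p dvd fact n" using p by (simp add: prime_dvd_fact_iff)
        moreover have "\<not> p dvd fact m" "\<not> p dvd fact (n - m)"
          using p m by (simp_all only: prime_dvd_fact_iff)
        ultimately have "p dvd fact m * fact (n - m) * (n choose m)" by simp
        with \<open>\<not> p dvd fact m\<close> \<open>\<not> p dvd fact (n - m)\<close> show ?thesis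
          using p(1) by (simp only: prime_dvd_mult_iff) simp
      qed
      then show ?thesis
        using fin by (intro prod_primes_dvd) (auto simp: A_def)
    qed
    then have A_le: "\<Prod>A \<le> (n choose m)"
      using m by (intro dvd_imp_le) (auto simp: zero_less_binomial_iff)
    \<comment> \<open>Row \<open>n = 2 * m + 1\<close> contains this coefficient twice, at
      \<open>m\<close> and at \<open>m + 1\<close>.\<close>
    have "2 * (n choose m) \<le> 2 ^ n"
    proof -
      have "(n choose m) + (n choose (m + 1)) = (\<Sum>k\<in>{m, m + 1}. n choose k)" by simp
      also have "\<dots> \<le> (\<Sum>k\<le>n. n choose k)" using m by (intro sum_mono2) auto
      also have "\<dots> = 2 ^ n" by (rule choose_row_sum)
      finally show ?thesis using binomial_symmetric[of m n] m by simp
    qed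
    then have "(n choose m) \<le> 4 ^ m" using m by (simp add: power_mult)
    with A_le have 1: "\<Prod>A \<le> 4 ^ m" by (rule le_trans)
    have "{p. prime p \<and> p \<le> n} = {p. prime p \<and> p \<le> m + 1} \<union> A"
      using m unfolding A_def by auto
    then have "(\<Prod>p | prime p \<and> p \<le> n. p) = (\<Prod>p | prime p \<and> p \<le> m + 1. p) * \<Prod>A"
      by (simp only:) (rule prod.union_disjoint, auto simp: A_def)
    also have "\<dots> \<le> 4 ^ (m + 1) * 4 ^ m"
      using less[of "m + 1"] m \<open>m \<ge> 1\<close> 1 by (intro mult_le_mono) auto
    also have "\<dots> = 4 ^ n" by (simp add: m power_add[symmetric] mult_2)
    finally show ?thesis .
  qed
qed

text \<open>Every prime counted exceeds \<open>s\<close>, so \<open>s\<close> raised to their number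
  is at most the primorial of \<open>n\<close>.\<close>

lemma card_primes_between_le:
  fixes s :: real
  assumes "s > 1"
  shows "real (card {p. prime p \<and> s < real p \<and> p \<le> n}) \<le> real n * ln 4 / ln s"
proof -
  let ?A = "{p. prime p \<and> s < real p \<and> p \<le> n}"
  have "s ^ card ?A = (\<Prod>p\<in>?A. s)" by simp
  also have "\<dots> \<le> (\<Prod>p\<in>?A. real p)" using assms by (intro prod_mono) auto
  also have "\<dots> \<le> (\<Prod>p | prime p \<and> p \<le> n. real p)"
    by (intro prod_mono2) (auto dest: prime_ge_1_nat)
  also have "\<dots> \<le> 4 ^ n"
    using primorial_le[of n, folded of_nat_le_iff[where ?'a = real]] by simp
  finally have "ln (s ^ card ?A) \<le> ln (4 ^ n)" using assms by (subst ln_le_cancel_iff) auto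
  then show ?thesis using assms by (simp add: ln_realpow field_simps)
qed

section \<open>Integers without a large prime factor of multiplicity one\<close>

text \<open>Unitary means coprime to the cofactor, so that \<sigma>(m) = (q + 1) \<sigma>(k). The
  cofactor \<open>k\<close> is explicit because the counting arguments run over it.\<close>

definition has_large_unitary_prime :: "real \<Rightarrow> nat \<Rightarrow> bool" where
  "has_large_unitary_prime Y m \<longleftrightarrow>
     (\<exists>k q. m = k * q \<and> prime q \<and> \<not> q dvd k \<and> Y < real q)"

text \<open>Distinct sets of prime factors have distinct products, since
  \<open>prime_factors\<close> recovers the set, and each product divides \<open>n\<close>.\<close>

lemma two_power_card_prime_factors_le:
  assumes "n > 0"
  shows "2 ^ card (prime_factors n) \<le> card {d::nat. d dvd n}"
proof -
  have pf: "prime_factors (\<Prod>A) = A" if "A \<subseteq> prime_factors n" for A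
  proof -
    have "finite A" using that finite_subset by blast
    moreover have "\<And>p. p \<in> A \<Longrightarrow> prime p" using that by (auto simp: in_prime_factors_iff)
    ultimately show ?thesis
      by (subst prime_factors_prod) (auto simp: prime_prime_factors dest: prime_gt_0_nat)
  qed
  have "inj_on (\<lambda>A. \<Prod>A) (Pow (prime_factors n))"
    by (rule inj_on_inverseI[where g = prime_factors]) (use pf in auto)
  moreover have "(\<lambda>A. \<Prod>A) ` Pow (prime_factors n) \<subseteq> {d. d dvd n}"
    using finite_subset[of _ "prime_factors n"]
    by (auto intro!: prod_primes_dvd simp: in_prime_factors_iff)
  moreover have "finite {d. d dvd n}" using assms by simp
  ultimately have "card (Pow (prime_factors n)) \<le> card {d. d dvd n}"
    by (rule card_inj_on_le)
  then show ?thesis by (simp add: card_Pow)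
qed

lemma squarefree_prod_prime_factors:
  assumes "squarefree (r::nat)"
  shows "\<Prod>(prime_factors r) = r"
proof -
  have "r \<noteq> 0" using assms by (metis not_squarefree_0)
  then have "r = (\<Prod>p\<in>prime_factors r. p ^ multiplicity p r)"
    by (simp add: prime_factorization_nat)
  also have "\<dots> = \<Prod>(prime_factors r)"
    using assms \<open>r \<noteq> 0\<close>
    by (intro prod.cong refl) (auto simp: squarefree_factorial_semiring' )
  finally show ?thesis by simp
qed

text \<open>The square of \<open>square_part m\<close> divides \<open>m\<close>, so the count is at
  most the sum of N / s^2 over s > W.\<close>

lemma card_large_square_part_le:
  assumes W: "W \<ge> 1"
  shows "real (card {m\<in>{1..N}. W < real (square_part m)}) \<le> 2 * real N / W"
proof -
  \<comment> \<open>Rounding \<open>W \<ge> 1\<close> down at most halves it; this produces the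
    factor 2.\<close>
  define k where "k = nat \<lfloor>W\<rfloor>"
  have k: "k \<ge> 1" "W / 2 \<le> real k" "real k \<le> W"
  proof -
    have "1 \<le> \<lfloor>W\<rfloor>" using W by simp
    then have "real k = of_int \<lfloor>W\<rfloor>" "1 \<le> real_of_int \<lfloor>W\<rfloor>" by (simp_all add: k_def)
    then show "k \<ge> 1" "W / 2 \<le> real k" "real k \<le> W" by linarith+
  qed
  have "{m\<in>{1..N}. W < real (square_part m)} \<subseteq> (\<Union>s\<in>{k<..N}. {m\<in>{1..N}. s\<^sup>2 dvd m})"
  proof
    fix m assume m: "m \<in> {m\<in>{1..N}. W < real (square_part m)}"
    then have "W < real (square_part m)" by simp
    then have "k < square_part m" using k by linarith
    moreover have dvd: "(square_part m)\<^sup>2 dvd m" by simp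
    moreover from dvd m have "(square_part m)\<^sup>2 \<le> N"
      by (intro order_trans[OF dvd_imp_le[OF dvd]]) auto
    then have "square_part m \<le> N" by (rule power2_nat_le_imp_le)
    ultimately show "m \<in> (\<Union>s\<in>{k<..N}. {m\<in>{1..N}. s\<^sup>2 dvd m})"
      using m by (intro UN_I[of "square_part m"]) simp_all
  qed
  then have "card {m\<in>{1..N}. W < real (square_part m)} \<le> (\<Sum>s\<in>{k<..N}. card {m\<in>{1..N}. s\<^sup>2 dvd m})"
    by (intro order_trans[OF card_mono card_UN_le]) auto
  also have "\<dots> = (\<Sum>s\<in>{k<..N}. N div s\<^sup>2)"
    by (intro sum.cong refl card_multiples) auto
  finally have "real (card {m\<in>{1..N}. W < real (square_part m)}) \<le> real (\<Sum>s\<in>{k<..N}. N div s\<^sup>2)"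
    by (rule of_nat_mono)
  also have "\<dots> \<le> (\<Sum>s\<in>{k<..N}. real N * (1 / (real s)\<^sup>2))"
    unfolding of_nat_sum by (intro sum_mono) (metis mult.right_neutral of_nat_div_le_of_nat of_nat_power times_divide_eq_right)
  also have "\<dots> = real N * (\<Sum>s\<in>{k<..N}. 1 / (real s)\<^sup>2)" by (simp add: sum_distrib_left)
  also have "\<dots> \<le> real N * (1 / real k)"
    using sum_inverse_squares_tail_le[OF k(1)] by (intro mult_left_mono) auto
  also have "\<dots> \<le> real N * (2 / W)"
    using k W by (intro mult_left_mono) (auto simp: field_simps)
  finally show ?thesis by (simp add: field_simps)
qed

text \<open>Markov's inequality, applied to the number of divisors.\<close>

lemma card_many_divisors_le:
  assumes "T > 0" "N \<ge> 1"
  shows "real (card {m\<in>{1..N}. T \<le> real (card {d. d dvd m})}) \<le> real N * (1 + ln (real N)) / T"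
proof -
  let ?A = "{m\<in>{1..N}. T \<le> real (card {d. d dvd m})}"
  have "real (card ?A) * T = (\<Sum>m\<in>?A. T)" by simp
  also have "\<dots> \<le> (\<Sum>m\<in>?A. real (card {d. d dvd m}))" by (intro sum_mono) auto
  also have "\<dots> \<le> (\<Sum>m\<in>{1..N}. real (card {d. d dvd m}))" by (intro sum_mono2) auto
  also have "\<dots> \<le> real N * (1 + ln (real N))" by (rule sum_divisor_count_le[OF assms(2)])
  finally show ?thesis using assms by (simp add: field_simps)
qed

text \<open>
  Write \<open>m = r s\<^sup>2\<close> with \<open>r\<close> squarefree. If \<open>s \<le> W \<le> Y\<close> then a prime factor of \<open>r\<close> exceeding
  \<open>Y\<close> cannot divide \<open>s\<close>, so it would divide \<open>m\<close> exactly once.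
\<close>
lemma le_if_no_large_unitary_prime:
  assumes m: "m > 0" "\<not> has_large_unitary_prime Y m"
    and s: "real (square_part m) \<le> W" and T: "real (card {d. d dvd m}) \<le> T"
    and WY: "1 \<le> W" "W \<le> Y"
  shows "real m \<le> W\<^sup>2 * Y powr log 2 T"
proof -
  define r where "r = squarefree_part m"
  define s where "s = square_part m"
  have msr: "m = r * s\<^sup>2" unfolding r_def s_def by (rule squarefree_decompose)
  have sf: "squarefree r" by (simp add: r_def)
  have "r > 0" using m msr by (cases r) auto
  have le_Y: "real q \<le> Y" if q: "q \<in> prime_factors r" for q
  proof (rule ccontr)
    assume "\<not> real q \<le> Y"
    have "prime q" "q dvd m" using q msr by (auto simp: in_prime_factors_iff)
    then obtain k where k: "m = k * q" by (auto elim: dvdE simp: mult.commute)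
    have "q dvd k"
    proof (rule ccontr)
      assume "\<not> q dvd k"
      with k \<open>prime q\<close> \<open>\<not> real q \<le> Y\<close> have "has_large_unitary_prime Y m"
        unfolding has_large_unitary_prime_def not_le by blast
      with m(2) show False ..
    qed
    then have "q\<^sup>2 dvd m" using k by (simp add: power2_eq_square)
    then have "q dvd s" unfolding s_def by (simp add: dvd_square_part_iff)
    then have "q \<le> s" using m msr by (intro dvd_imp_le) auto
    then have "real q \<le> W" using assms(3) by (simp add: s_def)
    with \<open>\<not> real q \<le> Y\<close> WY show False by linarith
  qed
  have "real r = (\<Prod>q\<in>prime_factors r. real q)"
    by (simp add: squarefree_prod_prime_factors[OF sf] flip: of_nat_prod)
  also have "\<dots> \<le> (\<Prod>q\<in>prime_factors r. Y)" using le_Y by (intro prod_mono) auto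
  also have "\<dots> = Y powr real (card (prime_factors r))"
    using WY by (simp add: powr_realpow)
  \<comment> \<open>The number \<open>r\<close> has at least
    \<open>2 ^ card (prime_factors r)\<close> divisors, all of them divisors of \<open>m\<close>, so
    \<open>T\<close> limits how many factors \<open>Y\<close> occur.\<close>
  also have "\<dots> \<le> Y powr log 2 T"
  proof -
    have "2 ^ card (prime_factors r) \<le> card {d. d dvd r}"
      by (rule two_power_card_prime_factors_le) fact
    also have "\<dots> \<le> card {d. d dvd m}"
      using m msr by (intro card_mono) auto
    finally have "real (2 ^ card (prime_factors r)) \<le> real (card {d. d dvd m})"
      by (rule of_nat_mono)
    from order_trans[OF this T] have "2 ^ card (prime_factors r) \<le> T" by simp
    then have "real (card (prime_factors r)) \<le> log 2 T"
      by (intro le_log_of_power) auto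
    then show ?thesis using WY by (intro powr_mono) auto
  qed
  finally have "real r \<le> Y powr log 2 T" .
  moreover have "(real s)\<^sup>2 \<le> W\<^sup>2" using assms(3) by (intro power_mono) (auto simp: s_def)
  ultimately have "real r * (real s)\<^sup>2 \<le> Y powr log 2 T * W\<^sup>2"
    by (intro mult_mono) auto
  then show ?thesis by (simp add: msr mult.commute)
qed

text \<open>The three terms account for the \<open>m\<close> with square part above
  \<open>W\<close>, those with at least \<open>T\<close> divisors, and the rest, which are small by
  \<open>le_if_no_large_unitary_prime\<close>.\<close>

lemma card_no_large_unitary_prime_le:
  assumes "1 \<le> W" "W \<le> Y" "T > 0" "N \<ge> 1"
  shows "real (card {m\<in>{1..N}. \<not> has_large_unitary_prime Y m})
           \<le> 2 * real N / W + real N * (1 + ln (real N)) / T + W\<^sup>2 * Y powr log 2 T"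
proof -
  let ?A = "{m\<in>{1..N}. W < real (square_part m)}"
  let ?B = "{m\<in>{1..N}. T \<le> real (card {d. d dvd m})}"
  let ?V = "W\<^sup>2 * Y powr log 2 T"
  let ?C = "{1..nat \<lfloor>?V\<rfloor>}"
  have "{m\<in>{1..N}. \<not> has_large_unitary_prime Y m} \<subseteq> ?A \<union> ?B \<union> ?C"
  proof
    fix m assume m: "m \<in> {m\<in>{1..N}. \<not> has_large_unitary_prime Y m}"
    show "m \<in> ?A \<union> ?B \<union> ?C"
    proof (rule ccontr)
      assume *: "m \<notin> ?A \<union> ?B \<union> ?C"
      with m have "real m \<le> ?V"
        using assms by (intro le_if_no_large_unitary_prime) auto
      then have "m \<le> nat \<lfloor>?V\<rfloor>" by (simp add: le_nat_floor)
      with * m show False by auto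
    qed
  qed
  then have "card {m\<in>{1..N}. \<not> has_large_unitary_prime Y m} \<le> card (?A \<union> ?B \<union> ?C)"
    by (intro card_mono) auto
  also have "\<dots> \<le> card ?A + card ?B + card ?C"
    by (intro order_trans[OF card_Un_le] add_mono order_refl card_Un_le)
  finally have "real (card {m\<in>{1..N}. \<not> has_large_unitary_prime Y m})
      \<le> real (card ?A) + real (card ?B) + real (card ?C)" by linarith
  also have "\<dots> \<le> 2 * real N / W + real N * (1 + ln (real N)) / T + ?V"
  proof (intro add_mono)
    show "real (card ?A) \<le> 2 * real N / W" by (rule card_large_square_part_le) fact
    show "real (card ?B) \<le> real N * (1 + ln (real N)) / T" by (rule card_many_divisors_le) fact+
    show "real (card ?C) \<le> ?V" by simp
  qed
  finally show ?thesis .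
qed

text \<open>The finitely many \<open>N\<close> below the threshold are absorbed into the constant by
  the trivial bound. With the quantifier over \<open>a\<close> inside \<open>eventually\<close>, the
  threshold and hence the constant are uniform in \<open>a\<close>.\<close>

lemma eventually_imp_bound_div_ln:
  fixes f :: "'a \<Rightarrow> nat \<Rightarrow> real"
  assumes ev: "eventually (\<lambda>N. \<forall>a. f a N \<le> C * real N / ln (real N) ^ k) sequentially"
    and triv: "\<And>a N. f a N \<le> real N"
  shows "\<exists>C>0. \<forall>a. \<forall>N\<ge>2. f a N \<le> C * real N / ln (real N) ^ k"
proof -
  from ev obtain N0 where N0: "\<And>N a. N \<ge> N0 \<Longrightarrow> f a N \<le> C * real N / ln (real N) ^ k"
    by (auto simp: eventually_sequentially)
  \<comment> \<open>For \<open>N < N0\<close> this gives \<open>ln (real N) ^ k \<le> D\<close>, so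
    the trivial bound suffices; the entry 1 keeps \<open>D\<close> positive.\<close>
  define D where "D = max 1 (max C (ln (real (N0 + 2)) ^ k))"
  have "f a N \<le> D * real N / ln (real N) ^ k" if N: "N \<ge> 2" for a N
  proof (cases "N \<ge> N0")
    case True
    have "C * real N / ln (real N) ^ k \<le> D * real N / ln (real N) ^ k"
      using N unfolding D_def by (intro divide_right_mono mult_right_mono) auto
    with N0[OF True, of a] show ?thesis by linarith
  next
    case False
    have L: "ln (real N) > 0" using N by simp
    have "ln (real N) ^ k \<le> ln (real (N0 + 2)) ^ k"
      using False N by (intro power_mono) auto
    also have "\<dots> \<le> D" by (simp add: D_def)
    finally have "real N * ln (real N) ^ k \<le> real N * D" by (intro mult_left_mono) auto
    then have "real N \<le> D * real N / ln (real N) ^ k"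
      using L by (simp add: pos_le_divide_eq mult.commute)
    with triv[of a N] show ?thesis by linarith
  qed
  moreover have "D > 0" by (simp add: D_def)
  ultimately show ?thesis by blast
qed

text \<open>With L = ln N, the parameters are W = L^2, Y = L^8 and T = L^3. The last of the three
  terms is then exp(O((ln L)^2)), eventually below any fixed positive power of \<open>N\<close>; the
  constant is 5 = 2 + 2 + 1.\<close>

lemma card_no_large_unitary_prime_bound:
  "eventually (\<lambda>N. real (card {m\<in>{1..N}. \<not> has_large_unitary_prime (ln (real N) ^ 8) m})
     \<le> 5 * real N / ln (real N) ^ 2) sequentially"
proof -
  have "eventually (\<lambda>N. 1 \<le> ln (real N) ^ 2) sequentially"
    and "eventually (\<lambda>N. ln (real N) ^ 2 \<le> ln (real N) ^ 8) sequentially"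
    and "eventually (\<lambda>N. ln (real N) ^ 3 > 0) sequentially"
    and "eventually (\<lambda>N. real N * (1 + ln (real N)) / ln (real N) ^ 3 \<le> 2 * real N / ln (real N) ^ 2) sequentially"
    and "eventually (\<lambda>N. (ln (real N) ^ 2)\<^sup>2 * (ln (real N) ^ 8) powr (log 2 (ln (real N) ^ 3))
           \<le> real N / ln (real N) ^ 2) sequentially"
    unfolding log_def by real_asymp+
  then show ?thesis using eventually_ge_at_top[of 1]
  proof eventually_elim
    case (elim N)
    from card_no_large_unitary_prime_le[OF elim(1,2,3,6)] elim(4,5)
    show ?case by (simp add: add_divide_distrib)
  qed
qed

lemma card_filter_atLeastAtMost_le: "real (card {m\<in>{1..N}. P m}) \<le> real N"
proof -
  have "card {m\<in>{1..N}. P m} \<le> card {1..N}" by (intro card_mono) auto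
  then show ?thesis by simp
qed

section \<open>Fibres of the divisor sum, and large common divisors\<close>

text \<open>This serves both for fixed values of \<sigma>(m) and for fixed ratios \<sigma>(m) / m.
  If \<open>P\<close> leaves one choice of \<open>q\<close> for each cofactor \<open>k\<close>, then
  \<open>k\<close> determines \<open>m\<close>, and \<open>Y < q\<close> forces
  \<open>k \<le> N / Y\<close>.\<close>

lemma card_unitary_prime_fibres_le:
  assumes Y: "Y > 0"
    and det: "\<And>k q q'. \<lbrakk>P (k * q); P (k * q'); k > 0; prime q; prime q'; \<not> q dvd k; \<not> q' dvd k\<rbrakk> \<Longrightarrow> q = q'"
  shows "real (card {m\<in>{1..N}. P m \<and> has_large_unitary_prime Y m}) \<le> real N / Y"
proof -
  let ?A = "{m\<in>{1..N}. P m \<and> has_large_unitary_prime Y m}"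
  have "\<forall>m\<in>?A. \<exists>k q. m = k * q \<and> prime q \<and> \<not> q dvd k \<and> Y < real q"
    by (auto simp: has_large_unitary_prime_def)
  then obtain k q where kq: "\<And>m. m \<in> ?A \<Longrightarrow>
      m = k m * q m \<and> prime (q m) \<and> \<not> q m dvd k m \<and> Y < real (q m)"
    by metis
  have "inj_on k ?A"
  proof (rule inj_onI)
    fix m m' assume m: "m \<in> ?A" "m' \<in> ?A" "k m = k m'"
    then have "q m = q m'"
      using kq[OF m(1)] kq[OF m(2)] by (intro det[of "k m"]) (auto intro: Nat.gr0I)
    with kq[OF m(1)] kq[OF m(2)] m(3) show "m = m'" by simp
  qed
  moreover have "k m \<in> {1..nat \<lfloor>real N / Y\<rfloor>}" if m: "m \<in> ?A" for m
  proof -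
    have "k m > 0" using kq[OF m] m by (auto intro: Nat.gr0I)
    have "real (k m) * Y \<le> real (k m) * real (q m)"
      using kq[OF m] by (intro mult_left_mono) auto
    also have "\<dots> = real m" unfolding of_nat_mult[symmetric] using kq[OF m] by presburger
    also have "\<dots> \<le> real N" using m by simp
    finally have "real (k m) \<le> real N / Y" using Y by (simp add: field_simps)
    with \<open>k m > 0\<close> show ?thesis by (auto simp: le_nat_floor)
  qed
  then have "k ` ?A \<subseteq> {1..nat \<lfloor>real N / Y\<rfloor>}" by blast
  ultimately have "card ?A \<le> card {1..nat \<lfloor>real N / Y\<rfloor>}"
    by (intro card_inj_on_le) auto
  then have "real (card ?A) \<le> real (nat \<lfloor>real N / Y\<rfloor>)" by simp
  also have "\<dots> \<le> real N / Y" using Y by simp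
  finally show ?thesis .
qed

text \<open>Given \<open>k\<close>, the equation (q + 1) \<sigma>(k) = b determines
  \<open>q\<close>. The constant 6 is 5 for the \<open>m\<close> without a large unitary prime, plus
  1 for the others.\<close>

lemma card_divisor_sigma_fibre_bound:
  "\<exists>C>0. \<forall>b. \<forall>N\<ge>2. real (card {m\<in>{1..N}. divisor_sigma m = b}) \<le> C * real N / ln (real N) ^ 2"
proof (rule eventually_imp_bound_div_ln)
  show "real (card {m\<in>{1..N}. divisor_sigma m = b}) \<le> real N" for b N
    by (rule card_filter_atLeastAtMost_le)
  have "eventually (\<lambda>N. real N / ln (real N) ^ 8 \<le> real N / ln (real N) ^ 2) sequentially"
    and "eventually (\<lambda>N. ln (real N) ^ 8 > 0) sequentially"
    by real_asymp+
  with card_no_large_unitary_prime_bound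
  show "eventually (\<lambda>N. \<forall>b. real (card {m\<in>{1..N}. divisor_sigma m = b})
          \<le> 6 * real N / ln (real N) ^ 2) sequentially"
  proof eventually_elim
    case (elim N)
    show ?case
    proof
      fix b
      let ?Y = "ln (real N) ^ 8"
      let ?A = "{m\<in>{1..N}. divisor_sigma m = b}"
      let ?B = "{m\<in>{1..N}. \<not> has_large_unitary_prime ?Y m}"
      let ?C = "{m\<in>{1..N}. divisor_sigma m = b \<and> has_large_unitary_prime ?Y m}"
      have "card ?A \<le> card (?B \<union> ?C)" by (intro card_mono) auto
      also have "\<dots> \<le> card ?B + card ?C" by (rule card_Un_le)
      finally have "real (card ?A) \<le> real (card ?B) + real (card ?C)" by linarith
      moreover have "real (card ?C) \<le> real N / ?Y"
      proof (rule card_unitary_prime_fibres_le)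
        fix k q q' :: nat
        assume *: "divisor_sigma (k * q) = b" "divisor_sigma (k * q') = b" "k > 0"
          "prime q" "prime q'" "\<not> q dvd k" "\<not> q' dvd k"
        then have "(q + 1) * divisor_sigma k = (q' + 1) * divisor_sigma k"
          by (metis divisor_sigma_mult_prime)
        with divisor_sigma_pos[OF \<open>k > 0\<close>] show "q = q'" by simp
      qed (use elim in simp)
      ultimately show "real (card ?A) \<le> 6 * real N / ln (real N) ^ 2" using elim by simp
    qed
  qed
qed

text \<open>
  If \<open>d = m / gcd(m, \<sigma>(m)) \<le> D\<close> then \<open>\<sigma>(m) / m\<close> is one of few fractions \<open>c / d\<close>, and
  \<open>(1 + 1/q) \<sigma>(k) / k = c / d\<close> determines \<open>q\<close> from \<open>k\<close>.
\<close>
lemma card_large_gcd_divisor_sigma_le: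
  assumes Y: "Y > 0" and D: "D \<ge> 0" and N: "N \<ge> 1"
  shows "real (card {m\<in>{1..N}. real m \<le> D * real (gcd m (divisor_sigma m))})
     \<le> real (card {m\<in>{1..N}. \<not> has_large_unitary_prime Y m})
         + D * (D * (1 + ln (real N))) * (real N / Y)"
proof -
  \<comment> \<open>Since \<sigma>(m) / m is at most 1 + ln N, a reduced denominator
    \<open>d \<le> D\<close> leaves a numerator \<open>c \<le> E\<close>.\<close>
  define E where "E = D * (1 + ln (real N))"
  have E: "E \<ge> 0" using D N unfolding E_def by simp
  let ?A = "{m\<in>{1..N}. real m \<le> D * real (gcd m (divisor_sigma m))}"
  let ?B = "{m\<in>{1..N}. \<not> has_large_unitary_prime Y m}"
  let ?P = "\<lambda>d c m. divisor_sigma m * d = c * m"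
  let ?C = "\<lambda>d c. {m\<in>{1..N}. ?P d c m \<and> has_large_unitary_prime Y m}"
  let ?I = "{1..nat \<lfloor>D\<rfloor>} \<times> {1..nat \<lfloor>E\<rfloor>}"
  have "?A \<subseteq> ?B \<union> (\<Union>(d, c)\<in>?I. ?C d c)"
  proof
    fix m assume m: "m \<in> ?A"
    then have "m > 0" by auto
    define g where "g = gcd m (divisor_sigma m)"
    define d where "d = m div g"
    define c where "c = divisor_sigma m div g"
    have "g > 0" using \<open>m > 0\<close> by (simp add: g_def)
    have md: "m = d * g" and sc: "divisor_sigma m = c * g" by (simp_all add: d_def c_def g_def)
    have rm: "real m = real d * real g" and rs: "real (divisor_sigma m) = real c * real g"
      unfolding md[symmetric] sc[symmetric] of_nat_mult[symmetric] by (rule refl)+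
    have "real m \<le> D * real g" using m by (simp add: g_def)
    then have "real d * real g \<le> D * real g" by (simp only: rm)
    then have dD: "real d \<le> D" using \<open>g > 0\<close> by simp
    have "real c * real g \<le> real d * real g * (1 + ln (real m))"
      using divisor_sigma_le[OF \<open>m > 0\<close>] by (simp only: rm[symmetric] rs[symmetric])
    then have "real c * real g \<le> real d * (1 + ln (real m)) * real g" by (simp add: algebra_simps)
    then have "real c \<le> real d * (1 + ln (real m))" using \<open>g > 0\<close> by simp
    also have "\<dots> \<le> E" unfolding E_def using dD m D by (intro mult_mono) auto
    finally have cE: "real c \<le> E" .
    have "d > 0" "c > 0" using md sc \<open>m > 0\<close> divisor_sigma_pos[OF \<open>m > 0\<close>] by (auto intro: Nat.gr0I)
    then have "(d, c) \<in> ?I" using dD cE by (auto simp: le_nat_floor)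
    moreover have "?P d c m" 
      using arg_cong[OF md, of "\<lambda>x. c * x"] arg_cong[OF sc, of "\<lambda>x. x * d"]
      by (simp only: mult_ac)
    ultimately show "m \<in> ?B \<union> (\<Union>(d, c)\<in>?I. ?C d c)" using m by blast
  qed
  then have "card ?A \<le> card (?B \<union> (\<Union>(d, c)\<in>?I. ?C d c))" by (intro card_mono) auto
  also have "\<dots> \<le> card ?B + (\<Sum>(d, c)\<in>?I. card (?C d c))"
    by (intro order_trans[OF card_Un_le] add_mono order_refl order_trans[OF card_UN_le])
       (auto intro!: sum_mono)
  finally have "real (card ?A) \<le> real (card ?B) + (\<Sum>(d, c)\<in>?I. real (card (?C d c)))"
    by (simp add: case_prod_beta flip: of_nat_sum of_nat_add)
  also have "(\<Sum>(d, c)\<in>?I. real (card (?C d c))) \<le> (\<Sum>(d, c)\<in>?I. real N / Y)"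
  proof (intro sum_mono, clarify)
    fix d c assume dc: "d \<in> {1..nat \<lfloor>D\<rfloor>}" "c \<in> {1..nat \<lfloor>E\<rfloor>}"
    show "real (card (?C d c)) \<le> real N / Y"
    proof (rule card_unitary_prime_fibres_le[OF Y])
      fix k q q' :: nat
      assume *: "?P d c (k * q)" "?P d c (k * q')" "k > 0"
        "prime q" "prime q'" "\<not> q dvd k" "\<not> q' dvd k"
      then have 1: "(q + 1) * divisor_sigma k * d = c * (k * q)"
        and 2: "(q' + 1) * divisor_sigma k * d = c * (k * q')"
        by (simp_all add: divisor_sigma_mult_prime)
      \<comment> \<open>Multiplying each equation by the other prime makes the right-hand sides
        equal; cancelling \<open>u\<close> and then \<open>q * q'\<close> gives
        \<open>q = q'\<close>.\<close>
      define u where "u = divisor_sigma k * d"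
      have "u > 0" using dc divisor_sigma_pos[of k] * by (auto simp: u_def)
      have "(q + 1) * q' * u = (q + 1) * divisor_sigma k * d * q'"
        by (simp only: u_def mult_ac)
      also have "\<dots> = (c * (k * q')) * q" by (simp only: 1) (simp only: mult_ac)
      also have "\<dots> = (q' + 1) * q * u" by (simp only: 2[symmetric] u_def mult_ac)
      finally have "(q + 1) * q' = (q' + 1) * q" using \<open>u > 0\<close> by simp
      then show "q = q'" by simp
    qed
  qed
  also have "\<dots> = real (nat \<lfloor>D\<rfloor>) * real (nat \<lfloor>E\<rfloor>) * (real N / Y)"
    by (simp add: case_prod_beta card_cartesian_product)
  also have "\<dots> \<le> D * E * (real N / Y)"
    using D E Y by (intro mult_mono) auto
  finally show ?thesis by (simp add: E_def)
qed

text \<open>With D = L^2 and Y = L^8, where L = ln N, there are at most L^4 (1 + L) fractions,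
  outweighed by the factor L^8 saved on each.\<close>

lemma card_large_gcd_divisor_sigma_bound:
  "\<exists>C>0. \<forall>N\<ge>2. real (card {m\<in>{1..N}. real m \<le> ln (real N) ^ 2 * real (gcd m (divisor_sigma m))})
              \<le> C * real N / ln (real N) ^ 2"
proof -
  \<comment> \<open>The dummy parameter of type \<open>unit\<close> gives the shape that
    \<open>eventually_imp_bound_div_ln\<close> expects.\<close>
  let ?f = "\<lambda>(_::unit) N. real (card {m\<in>{1..N}. real m \<le> ln (real N) ^ 2 * real (gcd m (divisor_sigma m))})"
  have "\<exists>C>0. \<forall>a. \<forall>N\<ge>2. ?f a N \<le> C * real N / ln (real N) ^ 2"
  proof (rule eventually_imp_bound_div_ln)
    show "?f a N \<le> real N" for a N
      by (rule card_filter_atLeastAtMost_le)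
    have "eventually (\<lambda>N. ln (real N) ^ 2 * (ln (real N) ^ 2 * (1 + ln (real N))) * (real N / ln (real N) ^ 8)
            \<le> real N / ln (real N) ^ 2) sequentially"
      and "eventually (\<lambda>N. ln (real N) ^ 8 > 0) sequentially"
      by real_asymp+
    with card_no_large_unitary_prime_bound eventually_ge_at_top[of 1]
    show "eventually (\<lambda>N. \<forall>a. ?f a N \<le> 6 * real N / ln (real N) ^ 2) sequentially"
    proof eventually_elim
      case (elim N)
      then show ?case
        using card_large_gcd_divisor_sigma_le[OF elim(4) _ elim(2), of "ln (real N) ^ 2"] by simp
    qed
  qed
  then show ?thesis by auto
qed

section \<open>Sparse sets and residue classes\<close>

text \<open>Abel summation; the weights are 1 / t - 1 / (t + 1) = 1 / (t (t + 1)).\<close>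

lemma sum_inverse_by_parts:
  assumes "N \<ge> 1"
  shows "(\<Sum>m\<in>S \<inter> {1..N}. 1 / real m)
           = (\<Sum>t\<in>{1..<N}. real (card (S \<inter> {1..t})) / (real t * (real t + 1)))
             + real (card (S \<inter> {1..N})) / real N"
  using assms
proof (induction N rule: dec_induct)
  case base
  then show ?case by (cases "1 \<in> S") auto
next
  case (step n)
  define c where "c t = real (card (S \<inter> {1..t}))" for t
  have S_Suc: "S \<inter> {1..Suc n} = (if Suc n \<in> S then insert (Suc n) (S \<inter> {1..n}) else S \<inter> {1..n})"
    by (auto simp: le_Suc_eq)
  have c_Suc: "c (Suc n) = c n + (if Suc n \<in> S then 1 else 0)"
    unfolding c_def S_Suc by simp
  have "(\<Sum>m\<in>S \<inter> {1..Suc n}. 1 / real m)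
          = (\<Sum>m\<in>S \<inter> {1..n}. 1 / real m) + (if Suc n \<in> S then 1 else 0) / real (Suc n)"
    unfolding S_Suc by simp
  also have "\<dots> = (\<Sum>t\<in>{1..<n}. c t / (real t * (real t + 1))) + c n / real n
                    + (if Suc n \<in> S then 1 else 0) / real (Suc n)"
    unfolding c_def step.IH ..
  also have "c n / real n = c n / (real n * (real n + 1)) + c n / (real n + 1)"
  proof -
    have "a / x = a / (x * (x + 1)) + a / (x + 1)" if "x > 0" for a x :: real
      using that by (simp add: divide_simps) algebra
    from this[of "real n" "c n"] show ?thesis using step(1) by linarith
  qed
  also have "(\<Sum>t\<in>{1..<n}. c t / (real t * (real t + 1)))
               + (c n / (real n * (real n + 1)) + c n / (real n + 1))
               + (if Suc n \<in> S then 1 else 0) / real (Suc n)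
             = (\<Sum>t\<in>{1..<Suc n}. c t / (real t * (real t + 1))) + c (Suc n) / real (Suc n)"
    using step(1) by (simp add: c_Suc add_divide_distrib add.commute)
  finally show ?case by (simp only: c_def)
qed

text \<open>Partial summation carries a density bound on all initial segments over to reciprocals;
  this is how the rare \<open>m\<close> with large gcd are summed later.\<close>

lemma sum_inverse_le_if_sparse:
  assumes K: "\<And>t. t \<in> {1..N} \<Longrightarrow> real (card (S \<inter> {1..t})) \<le> K * real t" and N: "N \<ge> 1"
  shows "(\<Sum>m\<in>S \<inter> {1..N}. 1 / real m) \<le> K * harm N"
proof -
  have "(\<Sum>m\<in>S \<inter> {1..N}. 1 / real m)
           = (\<Sum>t\<in>{1..<N}. real (card (S \<inter> {1..t})) / (real t * (real t + 1)))
             + real (card (S \<inter> {1..N})) / real N"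
    by (rule sum_inverse_by_parts[OF N])
  also have "\<dots> \<le> (\<Sum>t\<in>{1..<N}. K * inverse (real (Suc t))) + K"
  proof (intro add_mono sum_mono)
    fix t assume t: "t \<in> {1..<N}"
    then have "real (card (S \<inter> {1..t})) / (real t * (real t + 1)) \<le> K * real t / (real t * (real t + 1))"
      by (intro divide_right_mono K) auto
    also have "\<dots> = K * inverse (real (Suc t))" using t by (simp add: divide_inverse add.commute)
    finally show "real (card (S \<inter> {1..t})) / (real t * (real t + 1)) \<le> K * inverse (real (Suc t))" .
    next
    show "real (card (S \<inter> {1..N})) / real N \<le> K" using K[of N] N by (simp add: pos_divide_le_eq)
  qed
  also have "\<dots> = K * harm N"
  proof -
    have "harm N = 1 + (\<Sum>t\<in>{1..<N}. inverse (real (Suc t)))"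
      using N by (induction N rule: dec_induct) (simp_all add: harm_def)
    then show ?thesis by (simp only: sum_distrib_left distrib_left mult_1_right add.commute)
  qed
  finally show ?thesis .
qed

text \<open>Elements with the same residue differ in their quotients by \<open>d\<close>, which lie
  between 0 and \<open>M div d\<close>; the quotient 0 accounts for the 1.\<close>

lemma card_le_if_all_cong:
  fixes Q :: "nat set"
  assumes Q: "Q \<subseteq> {1..M}" and d: "d > 0"
    and cong: "\<And>p q. p \<in> Q \<Longrightarrow> q \<in> Q \<Longrightarrow> [p = q] (mod d)"
  shows "real (card Q) \<le> 1 + real M / real d"
proof -
  have "inj_on (\<lambda>q. q div d) Q"
  proof (rule inj_onI)
    fix p q assume pq: "p \<in> Q" "q \<in> Q" "p div d = q div d"
    have "p mod d = q mod d" using cong[OF pq(1,2)] by (simp add: unique_euclidean_semiring_class.cong_def)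
    with pq(3) show "p = q" by (metis div_mult_mod_eq)
  qed
  moreover have "(\<lambda>q. q div d) ` Q \<subseteq> {0..M div d}"
    using Q by (auto intro!: div_le_mono)
  ultimately have "card Q \<le> card {0..M div d}" by (intro card_inj_on_le) auto
  then have "real (card Q) \<le> 1 + real (M div d)" by simp
  then show ?thesis using of_nat_div_le_of_nat[of M d, where ?'a = real] by linarith
qed

section \<open>The congruence\<close>

text \<open>For \<open>m\<close> of size about 2^j there are O(N / (2^j ln N)) primes
  \<open>q\<close>, and each leaves O(2^j / (j + 1)^2) values of \<open>m\<close> in one fibre of
  \<sigma>. The saving (j + 1)^2 makes the sum over \<open>j\<close> converge.\<close>

lemma card_small_cofactor_bound:
  "\<exists>C>0. \<forall>a N. N \<ge> 2 \<longrightarrow>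
     real (card {n\<in>{1..N}. [int (divisor_sigma n) = a] (mod int n) \<and>
       (\<exists>m q. n = m * q \<and> prime q \<and> \<not> q dvd m \<and> sqrt (real N) < real q \<and> divisor_sigma m < q)})
     \<le> C * real N / ln (real N)"
proof -
  obtain C where C: "C > 0" "\<And>b N. N \<ge> 2 \<Longrightarrow>
      real (card {m\<in>{1..N}. divisor_sigma m = b}) \<le> C * real N / ln (real N) ^ 2"
    using card_divisor_sigma_fibre_bound by blast
  have "real (card {n\<in>{1..N}. [int (divisor_sigma n) = a] (mod int n) \<and>
       (\<exists>m q. n = m * q \<and> prime q \<and> \<not> q dvd m \<and> sqrt (real N) < real q \<and> divisor_sigma m < q)})
     \<le> (16 * C / ln 2) * real N / ln (real N)" (is "real (card ?A) \<le> _") if N: "N \<ge> 2" for a N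
  proof -
    define Q where "Q j = {q. prime q \<and> sqrt (real N) < real q \<and> q \<le> N div 2 ^ j}" for j
    \<comment> \<open>The lower bound \<open>2 ^ j \<le> m\<close> is dropped, as the fibre bound
      concerns initial segments. The length \<open>2 ^ (j + 1)\<close> is at least 2 even for
      \<open>j = 0\<close>, as that bound requires.\<close>
    define F where "F j q = {m\<in>{1..2 ^ (j + 1)}. divisor_sigma m = nat (a mod int q)}" for j q
    have L: "ln (real N) > 0" using N by simp
    have finQ: "finite (Q j)" for j unfolding Q_def by (rule finite_subset[of _ "{..N div 2 ^ j}"]) auto
    have finF: "finite (F j q)" for j q unfolding F_def by simp
    have "?A \<subseteq> (\<Union>j\<in>{..N}. \<Union>q\<in>Q j. (\<lambda>m. m * q) ` F j q)"
    proof
      fix n assume "n \<in> ?A"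
      then obtain m q where n: "n \<in> {1..N}" "[int (divisor_sigma n) = a] (mod int n)"
        and mq: "n = m * q" "prime q" "\<not> q dvd m" "sqrt (real N) < real q" "divisor_sigma m < q"
        by blast
      have "m > 0" using n mq by (auto intro: Nat.gr0I)
      obtain j where j: "2 ^ j \<le> m" "m < 2 ^ (j + 1)"
        using ex_power_ivl1[of 2 m] \<open>m > 0\<close> by auto
      have "j < 2 ^ j" by (rule less_exp)
      moreover have "m \<le> N" using n mq by (metis atLeastAtMost_iff dvd_imp_le dvd_triv_left le_trans less_le_trans zero_less_one)
      ultimately have "j \<le> N" using j by linarith
      have "q * 2 ^ j \<le> q * m" using j by simp
      also have "\<dots> \<le> N" using n mq by (simp add: mult.commute)
      finally have "q \<in> Q j" using mq by (simp add: Q_def less_eq_div_iff_mult_less_eq)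
      \<comment> \<open>Modulo \<open>q\<close>, \<sigma>(n) = (q + 1) \<sigma>(m) reduces to
        \<sigma>(m), which is below \<open>q\<close> and hence equal to the residue of
        \<open>a\<close>.\<close>
      have "[int (divisor_sigma n) = a] (mod int q)"
        using n(2) mq(1) cong_dvd_modulus[of _ a "int n" "int q"] by simp
      moreover have "int (divisor_sigma n) = int (divisor_sigma m) + int q * int (divisor_sigma m)"
        using mq \<open>m > 0\<close> by (simp add: divisor_sigma_mult_prime algebra_simps)
      ultimately have "int (divisor_sigma m) mod int q = a mod int q"
        by (simp add: unique_euclidean_semiring_class.cong_def)
      then have "int (divisor_sigma m) = a mod int q" using mq(5) by simp
      then have "divisor_sigma m = nat (a mod int q)" by (metis nat_int)
      then have "m \<in> F j q" using j \<open>m > 0\<close> by (simp add: F_def)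
      with mq(1) \<open>j \<le> N\<close> \<open>q \<in> Q j\<close> show "n \<in> (\<Union>j\<in>{..N}. \<Union>q\<in>Q j. (\<lambda>m. m * q) ` F j q)"
        by blast
    qed
    then have "card ?A \<le> card (\<Union>j\<in>{..N}. \<Union>q\<in>Q j. (\<lambda>m. m * q) ` F j q)"
      using finQ finF by (intro card_mono) auto
    also have "\<dots> \<le> (\<Sum>j\<in>{..N}. card (\<Union>q\<in>Q j. (\<lambda>m. m * q) ` F j q))"
      by (intro card_UN_le) auto
    also have "\<dots> \<le> (\<Sum>j\<in>{..N}. \<Sum>q\<in>Q j. card (F j q))"
    proof (intro sum_mono)
      fix j
      have "card (\<Union>q\<in>Q j. (\<lambda>m. m * q) ` F j q) \<le> (\<Sum>q\<in>Q j. card ((\<lambda>m. m * q) ` F j q))"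
        by (rule card_UN_le[OF finQ])
      also have "\<dots> \<le> (\<Sum>q\<in>Q j. card (F j q))"
        by (intro sum_mono card_image_le finF)
      finally show "card (\<Union>q\<in>Q j. (\<lambda>m. m * q) ` F j q) \<le> (\<Sum>q\<in>Q j. card (F j q))" .
    qed
    finally have "real (card ?A) \<le> real (\<Sum>j\<in>{..N}. \<Sum>q\<in>Q j. card (F j q))"
      by (rule of_nat_mono)
    also have "\<dots> = (\<Sum>j\<in>{..N}. \<Sum>q\<in>Q j. real (card (F j q)))" by simp
    also have "\<dots> \<le> (\<Sum>j\<in>{..N}. (8 * C / ln 2 * real N / ln (real N)) * (1 / (real j + 1)\<^sup>2))"
    proof (intro sum_mono)
      fix j
      have ln4: "ln (4::real) = 2 * ln 2" using ln_realpow[of 2 2] by simp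
      have "(\<Sum>q\<in>Q j. real (card (F j q))) \<le> (\<Sum>q\<in>Q j. C * real (2 ^ (j + 1)) / ln (real (2 ^ (j + 1))) ^ 2)"
        unfolding F_def by (intro sum_mono C(2)) simp
      also have "\<dots> = real (card (Q j)) * (C * 2 ^ (j + 1) / ((real j + 1) * ln 2) ^ 2)"
        by (simp add: ln_realpow add.commute flip: power_Suc)
      also have "\<dots> \<le> (real N / 2 ^ j * ln 4 / ln (sqrt (real N))) * (C * 2 ^ (j + 1) / ((real j + 1) * ln 2) ^ 2)"
      proof (intro mult_right_mono)
        have "real (card (Q j)) \<le> real (N div 2 ^ j) * ln 4 / ln (sqrt (real N))"
          unfolding Q_def using N by (intro card_primes_between_le) simp
        also have "\<dots> \<le> real N / 2 ^ j * ln 4 / ln (sqrt (real N))"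
          using N of_nat_div_le_of_nat[of N "2 ^ j", where ?'a = real]
          by (intro divide_right_mono mult_right_mono) auto
        finally show "real (card (Q j)) \<le> real N / 2 ^ j * ln 4 / ln (sqrt (real N))" .
        show "0 \<le> C * 2 ^ (j + 1) / ((real j + 1) * ln 2) ^ 2" using C by simp
      qed
      \<comment> \<open>The constant 8 combines ln 4 = 2 ln 2, ln (sqrt N) = (ln N) / 2 and 2^(j +
        1) = 2 * 2^j.\<close>
      also have "\<dots> = (8 * C / ln 2 * real N / ln (real N)) * (1 / (real j + 1)\<^sup>2)"
        using N L by (simp add: ln_sqrt ln4 power_mult_distrib power2_eq_square mult_ac)
      finally show "(\<Sum>q\<in>Q j. real (card (F j q))) \<le> (8 * C / ln 2 * real N / ln (real N)) * (1 / (real j + 1)\<^sup>2)" .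
    qed
    also have "\<dots> = (8 * C / ln 2 * real N / ln (real N)) * (\<Sum>j\<le>N. 1 / (real j + 1)\<^sup>2)"
      by (rule sum_distrib_left[symmetric])
    also have "\<dots> \<le> (8 * C / ln 2 * real N / ln (real N)) * 2"
    proof (rule mult_left_mono)
      have "0 \<le> 1 / (real N + 1)" by simp
      with sum_inverse_squares_le[of N] show "(\<Sum>j\<le>N. 1 / (real j + 1)\<^sup>2) \<le> 2" by linarith
    qed (use C L in simp)
    finally show ?thesis by simp
  qed
  moreover have "16 * C / ln 2 > 0" using C by simp
  ultimately show ?thesis by blast
qed

text \<open>Modulo \<open>m\<close> the congruence fixes \<open>q \<le> N / m\<close> modulo m /
  gcd(m, \<sigma>(m)), which leaves at most 1 + N gcd(m, \<sigma>(m)) / m^2 values. The terms 1 add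
  up to at most \<open>N / Y\<close>, because \<open>Y < q\<close> forces
  \<open>m \<le> N / Y\<close>.\<close>

lemma card_large_cofactor_le:
  assumes Y: "Y > 0"
  shows "real (card {n\<in>{1..N}. [int (divisor_sigma n) = a] (mod int n) \<and>
       (\<exists>m q. n = m * q \<and> prime q \<and> \<not> q dvd m \<and> Y < real q \<and> M < real m)})
     \<le> real N / Y + real N * (\<Sum>m | m \<in> {1..N} \<and> M < real m. real (gcd m (divisor_sigma m)) / (real m)\<^sup>2)"
    (is "real (card ?A) \<le> _")
proof -
  define Q where "Q m = {q\<in>{1..N div m}. prime q \<and> \<not> q dvd m \<and> [int ((q + 1) * divisor_sigma m) = a] (mod int m)}" for m
  define I where "I = {m \<in> {1..N}. M < real m \<and> real m \<le> real N / Y}"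
  define J where "J = {m. m \<in> {1..N} \<and> M < real m}"
  have finQ: "finite (Q m)" for m by (simp add: Q_def)
  have finI: "finite I" and finJ: "finite J" and IJ: "I \<subseteq> J" by (auto simp: I_def J_def)
  have "?A \<subseteq> (\<Union>m\<in>I. (\<lambda>q. m * q) ` Q m)"
  proof
    fix n assume "n \<in> ?A"
    then obtain m q where n: "n \<in> {1..N}" "[int (divisor_sigma n) = a] (mod int n)"
      and mq: "n = m * q" "prime q" "\<not> q dvd m" "Y < real q" "M < real m"
      by blast
    have "m > 0" using n mq by (auto intro: Nat.gr0I)
    have "q > 0" using mq by (simp add: prime_gt_0_nat)
    have "real m * Y \<le> real m * real q" using mq by (intro mult_left_mono) auto
    also have "\<dots> = real n" by (simp add: mq(1))
    also have "\<dots> \<le> real N" using n by simp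
    finally have "real m \<le> real N / Y" using Y by (simp add: field_simps)
    moreover have "m \<le> n" using mq(1) \<open>q > 0\<close> by simp
    then have "m \<le> N" using n(1) by simp
    ultimately have "m \<in> I" using mq \<open>m > 0\<close> by (simp add: I_def)
    have "q \<le> N div m" using n mq \<open>m > 0\<close> by (simp add: less_eq_div_iff_mult_less_eq mult.commute)
    moreover have "[int (divisor_sigma n) = a] (mod int m)"
      using n(2) mq(1) cong_dvd_modulus[of _ a "int n" "int m"] by simp
    ultimately have "q \<in> Q m"
      using mq \<open>m > 0\<close> \<open>q > 0\<close> by (simp add: Q_def divisor_sigma_mult_prime)
    with mq(1) \<open>m \<in> I\<close> show "n \<in> (\<Union>m\<in>I. (\<lambda>q. m * q) ` Q m)" by blast
  qed
  then have "card ?A \<le> card (\<Union>m\<in>I. (\<lambda>q. m * q) ` Q m)"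
    using finQ finI by (intro card_mono) auto
  also have "\<dots> \<le> (\<Sum>m\<in>I. card ((\<lambda>q. m * q) ` Q m))" by (rule card_UN_le[OF finI])
  also have "\<dots> \<le> (\<Sum>m\<in>I. card (Q m))" by (intro sum_mono card_image_le finQ)
  finally have "real (card ?A) \<le> real (\<Sum>m\<in>I. card (Q m))" by (rule of_nat_mono)
  also have "\<dots> = (\<Sum>m\<in>I. real (card (Q m)))" by simp
  also have "\<dots> \<le> (\<Sum>m\<in>I. 1 + real N * (real (gcd m (divisor_sigma m)) / (real m)\<^sup>2))"
  proof (rule sum_mono)
    fix m assume "m \<in> I"
    then have "m > 0" by (simp add: I_def)
    define g where "g = gcd m (divisor_sigma m)"
    define d where "d = m div g"
    define c where "c = divisor_sigma m div g"
    have "g > 0" using \<open>m > 0\<close> by (simp add: g_def)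
    have md: "m = d * g" and sc: "divisor_sigma m = c * g" by (simp_all add: d_def c_def g_def)
    have "d > 0" using md \<open>m > 0\<close> by (auto intro: Nat.gr0I)
    have cop: "coprime d c"
      unfolding d_def c_def g_def using \<open>m > 0\<close> by (intro div_gcd_coprime) auto
    have "real (card (Q m)) \<le> 1 + real (N div m) / real d"
    proof (rule card_le_if_all_cong)
      fix p q assume "p \<in> Q m" "q \<in> Q m"
      \<comment> \<open>Comparing two solutions removes \<open>a\<close>; then \<open>g\<close>
        cancels, and \<open>c\<close> drops out because it is coprime to \<open>d\<close>.\<close>
      then have "[int ((p + 1) * divisor_sigma m) = int ((q + 1) * divisor_sigma m)] (mod int m)"
        unfolding Q_def using cong_trans cong_sym by blast
      then have "int m dvd int ((p + 1) * divisor_sigma m) - int ((q + 1) * divisor_sigma m)"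
        by (simp add: cong_iff_dvd_diff)
      also have "int ((p + 1) * divisor_sigma m) - int ((q + 1) * divisor_sigma m)
                   = (int p - int q) * int (divisor_sigma m)"
        by (simp add: algebra_simps)
      finally have "int d * int g dvd (int p - int q) * int c * int g"
        by (subst (asm) md, subst (asm) sc) (simp only: of_nat_mult mult.assoc)
      then have "int d dvd (int p - int q) * int c" using \<open>g > 0\<close> by simp
      then have "int d dvd int p - int q"
        using cop by (simp add: coprime_dvd_mult_left_iff)
      then show "[p = q] (mod d)"
        by (metis cong_iff_dvd_diff cong_int_iff)
    qed (use \<open>d > 0\<close> in \<open>auto simp: Q_def\<close>)
    also have "real (N div m) / real d \<le> real N / real m / real d"
      by (intro divide_right_mono of_nat_div_le_of_nat) auto
    also have "real N / real m / real d = real N * (real g / (real m)\<^sup>2)"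
    proof -
      have "real m = real d * real g" unfolding of_nat_mult[symmetric] md[symmetric] ..
      then have "real m / real g = real d" using \<open>g > 0\<close> by simp
      then show ?thesis by (simp add: power2_eq_square flip: \<open>real m / real g = real d\<close>)
    qed
    finally show "real (card (Q m)) \<le> 1 + real N * (real (gcd m (divisor_sigma m)) / (real m)\<^sup>2)"
      by (simp add: g_def)
  qed
  also have "\<dots> = real (card I) + real N * (\<Sum>m\<in>I. real (gcd m (divisor_sigma m)) / (real m)\<^sup>2)"
    by (simp add: sum.distrib sum_distrib_left)
  also have "\<dots> \<le> real N / Y + real N * (\<Sum>m\<in>J. real (gcd m (divisor_sigma m)) / (real m)\<^sup>2)"
  proof (intro add_mono mult_left_mono sum_mono2 finJ IJ)
    have "I \<subseteq> {1..nat \<lfloor>real N / Y\<rfloor>}" by (auto simp: I_def le_nat_floor)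
    then have "card I \<le> nat \<lfloor>real N / Y\<rfloor>" using card_mono[of "{1..nat \<lfloor>real N / Y\<rfloor>}" I] by simp
    then have "real (card I) \<le> real (nat \<lfloor>real N / Y\<rfloor>)" by simp
    also have "\<dots> \<le> real N / Y" using Y by simp
    finally show "real (card I) \<le> real N / Y" .
  qed auto
  finally show ?thesis by (simp add: J_def)
qed

text \<open>Write L = ln N; here ln m > L / 4. If gcd(m, \<sigma>(m)) < m / (ln m)^2, the term is at
  most 16 / (L^2 m). The other terms are at most 1 / m, over a set of density O(1 / L^2). Both parts
  sum to O(\<open>harm N\<close> / L^2) = O(1 / L).\<close>

lemma sum_gcd_divisor_sigma_tail_bound:
  "\<exists>C>0. \<forall>N. ln (real N) \<ge> 1 \<longrightarrow>
     (\<Sum>m | m \<in> {1..N} \<and> real N powr (1/4) < real m. real (gcd m (divisor_sigma m)) / (real m)\<^sup>2)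
       \<le> C / ln (real N)"
proof -
  obtain C where C: "C > 0" "\<And>N. N \<ge> 2 \<Longrightarrow>
     real (card {m\<in>{1..N}. real m \<le> ln (real N) ^ 2 * real (gcd m (divisor_sigma m))}) \<le> C * real N / ln (real N) ^ 2"
    using card_large_gcd_divisor_sigma_bound by blast
  have "(\<Sum>m | m \<in> {1..N} \<and> real N powr (1/4) < real m. real (gcd m (divisor_sigma m)) / (real m)\<^sup>2)
          \<le> (32 * (1 + C)) / ln (real N)" if L1: "ln (real N) \<ge> 1" for N
  proof -
    define L where "L = ln (real N)"
    define M where "M = real N powr (1/4)"
    define J where "J = {m. m \<in> {1..N} \<and> M < real m}"
    \<comment> \<open>With ln m in place of ln N, the part of \<open>S\<close> up to any
      \<open>t\<close> lies in the exceptional set for \<open>t\<close>, because ln m \<le> ln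
      t.\<close>
    define S where "S = {m. M < real m \<and> real m \<le> ln (real m) ^ 2 * real (gcd m (divisor_sigma m))}"
    have N: "N \<ge> 2"
    proof (rule ccontr)
      assume "\<not> N \<ge> 2"
      then have "N = 0 \<or> N = 1" by linarith
      then show False using L1 by auto
    qed
    have L: "L \<ge> 1" using L1 by (simp add: L_def)
    have M: "M \<ge> 1" using N by (simp add: M_def ge_one_powr_ge_zero)
    have lnM: "L / 4 < ln (real m)" if "M < real m" for m
    proof -
      have "ln M = L / 4" using N by (simp add: M_def L_def ln_powr)
      moreover have "ln M < ln (real m)" using that M by (subst ln_less_cancel_iff) auto
      ultimately show ?thesis by simp
    qed
    have sq: "L\<^sup>2 / 16 \<le> ln (real m) ^ 2" if "M < real m" for m
    proof -
      have "(L / 4)\<^sup>2 \<le> ln (real m) ^ 2" using lnM[OF that] L by (intro power_mono) auto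
      then show ?thesis by (simp add: power_divide)
    qed
    have "(\<Sum>m\<in>J. real (gcd m (divisor_sigma m)) / (real m)\<^sup>2)
            \<le> (\<Sum>m\<in>J. 16 / L\<^sup>2 * (1 / real m) + (if m \<in> S then 1 / real m else 0))"
    proof (rule sum_mono)
      fix m assume m: "m \<in> J"
      then have m0: "real m > 0" by (simp add: J_def)
      let ?g = "real (gcd m (divisor_sigma m))"
      show "?g / (real m)\<^sup>2 \<le> 16 / L\<^sup>2 * (1 / real m) + (if m \<in> S then 1 / real m else 0)"
      proof (cases "m \<in> S")
        case True
        have "gcd m (divisor_sigma m) \<le> m" using m0 by (intro gcd_le1_nat) simp
        then have "?g / (real m)\<^sup>2 \<le> real m / (real m)\<^sup>2" by (intro divide_right_mono) auto
        also have "\<dots> = 1 / real m" by (simp add: power2_eq_square)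
        also have "\<dots> \<le> 16 / L\<^sup>2 * (1 / real m) + 1 / real m" by simp
        finally show ?thesis using True by simp
      next
        case False
        then have "ln (real m) ^ 2 * ?g \<le> real m" using m by (simp add: S_def J_def)
        moreover have "L\<^sup>2 / 16 * ?g \<le> ln (real m) ^ 2 * ?g"
          using sq m by (intro mult_right_mono) (auto simp: J_def)
        ultimately have "L\<^sup>2 / 16 * ?g \<le> real m" by linarith
        then have "?g \<le> 16 / L\<^sup>2 * real m" using L by (simp add: field_simps)
        then have "?g / (real m)\<^sup>2 \<le> 16 / L\<^sup>2 * real m / (real m)\<^sup>2" by (intro divide_right_mono) auto
        also have "\<dots> = 16 / L\<^sup>2 * (1 / real m)" using m0 by (simp add: power2_eq_square)
        finally show ?thesis using False by simp
      qed
    qed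
    also have "\<dots> = 16 / L\<^sup>2 * (\<Sum>m\<in>J. 1 / real m) + (\<Sum>m\<in>J \<inter> S. 1 / real m)"
      by (simp only: sum.distrib sum_distrib_left) (simp add: J_def sum.inter_restrict)
    also have "\<dots> \<le> 16 / L\<^sup>2 * harm N + 16 * C / L\<^sup>2 * harm N"
    proof (rule add_mono)
      have "(\<Sum>m\<in>J. 1 / real m) \<le> (\<Sum>m\<in>{1..N}. 1 / real m)"
        by (intro sum_mono2) (auto simp: J_def)
      also have "\<dots> = harm N" by (simp add: harm_def divide_inverse)
      finally show "16 / L\<^sup>2 * (\<Sum>m\<in>J. 1 / real m) \<le> 16 / L\<^sup>2 * harm N"
        by (intro mult_left_mono) auto
      have "J \<inter> S = S \<inter> {1..N}" by (auto simp: J_def S_def)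
      moreover have "(\<Sum>m\<in>S \<inter> {1..N}. 1 / real m) \<le> 16 * C / L\<^sup>2 * harm N"
      proof (rule sum_inverse_le_if_sparse)
        fix t assume t: "t \<in> {1..N}"
        show "real (card (S \<inter> {1..t})) \<le> 16 * C / L\<^sup>2 * real t"
        \<comment> \<open>The available bound involves ln t, which is comparable to \<open>L\<close>
          only for \<open>t > M\<close>; up to \<open>M\<close> the set \<open>S\<close> is
          empty.\<close>
        proof (cases "M < real t")
          case False
          then have "S \<inter> {1..t} = {}" by (auto simp: S_def)
          then show ?thesis using C by simp
        next
          case True
          then have t2: "t \<ge> 2" using M by linarith
          have "S \<inter> {1..t} \<subseteq> {m\<in>{1..t}. real m \<le> ln (real t) ^ 2 * real (gcd m (divisor_sigma m))}"
          proof
            fix m assume m: "m \<in> S \<inter> {1..t}"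
            then have "real m \<le> ln (real m) ^ 2 * real (gcd m (divisor_sigma m))" by (simp add: S_def)
            also have "\<dots> \<le> ln (real t) ^ 2 * real (gcd m (divisor_sigma m))"
              using m by (intro mult_right_mono power_mono) auto
            finally show "m \<in> {m\<in>{1..t}. real m \<le> ln (real t) ^ 2 * real (gcd m (divisor_sigma m))}"
              using m by simp
          qed
          then have "real (card (S \<inter> {1..t}))
              \<le> real (card {m\<in>{1..t}. real m \<le> ln (real t) ^ 2 * real (gcd m (divisor_sigma m))})"
            by (intro of_nat_mono card_mono) auto
          also have "\<dots> \<le> C * real t / ln (real t) ^ 2" by (rule C(2)[OF t2])
          also have "\<dots> \<le> C * real t / (L\<^sup>2 / 16)"
            using sq[OF True] C L by (intro divide_left_mono mult_pos_pos) auto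
          finally show ?thesis by (simp add: mult_ac)
        qed
      qed (use N in simp)
      ultimately show "(\<Sum>m\<in>J \<inter> S. 1 / real m) \<le> 16 * C / L\<^sup>2 * harm N" by simp
    qed
    also have "\<dots> = 16 * (1 + C) / L\<^sup>2 * harm N"
      by (simp add: add_divide_distrib distrib_right)
    also have "\<dots> \<le> 16 * (1 + C) / L\<^sup>2 * (2 * L)"
    proof (rule mult_left_mono)
      show "harm N \<le> 2 * L" using harm_le_Suc_ln[of N] N L by (simp add: L_def)
    qed (use C in simp)
    also have "\<dots> = 32 * (1 + C) / L" using L by (simp add: power2_eq_square)
    finally show ?thesis by (simp add: J_def M_def L_def)
  qed
  moreover have "32 * (1 + C) > 0" using C by simp
  ultimately show ?thesis by blast
qed

text \<open>Four sets cover the solutions: \<open>n \<le> N / L\<close>, no large unitary prime,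
  small cofactor, and large cofactor. The exponent 1 matches
  \<open>eventually_imp_bound_div_ln\<close>.\<close>

lemma card_divisor_sigma_cong_bound:
  "\<exists>C>0. \<forall>a. \<forall>N\<ge>2. real (card {n\<in>{1..N}. [int (divisor_sigma n) = a] (mod int n)})
                      \<le> C * real N / ln (real N) ^ 1"
proof -
  obtain C1 where C1: "C1 > 0" "\<And>a N. N \<ge> 2 \<Longrightarrow>
     real (card {n\<in>{1..N}. [int (divisor_sigma n) = a] (mod int n) \<and>
       (\<exists>m q. n = m * q \<and> prime q \<and> \<not> q dvd m \<and> sqrt (real N) < real q \<and> divisor_sigma m < q)})
     \<le> C1 * real N / ln (real N)"
    using card_small_cofactor_bound by blast
  obtain C2 where C2: "C2 > 0" "\<And>N. ln (real N) \<ge> 1 \<Longrightarrow>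
     (\<Sum>m | m \<in> {1..N} \<and> real N powr (1/4) < real m. real (gcd m (divisor_sigma m)) / (real m)\<^sup>2)
       \<le> C2 / ln (real N)"
    using sum_gcd_divisor_sigma_tail_bound by blast
  show ?thesis
  proof (rule eventually_imp_bound_div_ln)
    show "real (card {n\<in>{1..N}. [int (divisor_sigma n) = a] (mod int n)}) \<le> real N" for a N
      by (rule card_filter_atLeastAtMost_le)
    have "eventually (\<lambda>N. ln (real N) \<ge> 1) sequentially"
      and "eventually (\<lambda>N. real N / ln (real N) ^ 8 \<le> real N / ln (real N)) sequentially"
      and "eventually (\<lambda>N. 5 * real N / ln (real N) ^ 2 \<le> 5 * real N / ln (real N)) sequentially"
      \<comment> \<open>This puts q = n / m above sqrt N when n > N / L and \<open>m\<close> is at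
        most the fourth root of \<open>N\<close>.\<close>
      and "eventually (\<lambda>N. sqrt (real N) \<le> real N / ln (real N) / real N powr (1/4)) sequentially"
      by real_asymp+
    with card_no_large_unitary_prime_bound eventually_ge_at_top[of 2]
    show "eventually (\<lambda>N. \<forall>a. real (card {n\<in>{1..N}. [int (divisor_sigma n) = a] (mod int n)})
            \<le> (7 + C1 + C2) * real N / ln (real N) ^ 1) sequentially"
    proof eventually_elim
      case (elim N)
      show ?case
      proof
        fix a
        define L where "L = ln (real N)"
        define M where "M = real N powr (1/4)"
        have L: "L \<ge> 1" using elim(3) by (simp add: L_def)
        let ?A = "{n\<in>{1..N}. [int (divisor_sigma n) = a] (mod int n)}"
        let ?B = "{1..nat \<lfloor>real N / L\<rfloor>}"
        let ?C = "{n\<in>{1..N}. \<not> has_large_unitary_prime (L ^ 8) n}"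
        let ?D = "{n\<in>{1..N}. [int (divisor_sigma n) = a] (mod int n) \<and>
          (\<exists>m q. n = m * q \<and> prime q \<and> \<not> q dvd m \<and> sqrt (real N) < real q \<and> divisor_sigma m < q)}"
        let ?E = "{n\<in>{1..N}. [int (divisor_sigma n) = a] (mod int n) \<and>
          (\<exists>m q. n = m * q \<and> prime q \<and> \<not> q dvd m \<and> L ^ 8 < real q \<and> M < real m)}"
        have "?A \<subseteq> ?B \<union> ?C \<union> ?D \<union> ?E"
        proof
          fix n assume n: "n \<in> ?A"
          show "n \<in> ?B \<union> ?C \<union> ?D \<union> ?E"
          proof (rule ccontr)
            assume *: "n \<notin> ?B \<union> ?C \<union> ?D \<union> ?E"
            from * n have "has_large_unitary_prime (L ^ 8) n" by simp
            then obtain m q where mq: "n = m * q" "prime q" "\<not> q dvd m" "L ^ 8 < real q"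
              unfolding has_large_unitary_prime_def by blast
            with * n have mM: "real m \<le> M" using not_le by blast
            have "m > 0" using n mq by (auto intro: Nat.gr0I)
            have "M > 0" using elim(2) by (simp add: M_def)
            have nL: "real N / L < real n"
            proof (rule ccontr)
              assume "\<not> real N / L < real n"
              then have "n \<le> nat \<lfloor>real N / L\<rfloor>" by (simp add: le_nat_floor)
              with * n show False by simp
            qed
            have "sqrt (real N) \<le> real N / L / M" using elim(6) by (simp add: L_def M_def)
            also have "\<dots> < real n / M" using nL \<open>M > 0\<close> by (intro divide_strict_right_mono)
            also have "\<dots> \<le> real n / real m"
              using mM \<open>m > 0\<close> \<open>M > 0\<close> by (intro divide_left_mono mult_pos_pos) auto
            also have "\<dots> = real q" using mq(1) \<open>m > 0\<close> by simp
            finally have qN: "sqrt (real N) < real q" .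
            \<comment> \<open>The crude quadratic bound is enough, because the square of
              \<open>M\<close> is exactly sqrt N.\<close>
            have "real (divisor_sigma m) \<le> (real m)\<^sup>2"
              using divisor_sigma_le_square[OF \<open>m > 0\<close>] by (metis of_nat_le_iff of_nat_power)
            also have "\<dots> \<le> M\<^sup>2" using mM by (intro power_mono) auto
            also have "\<dots> = sqrt (real N)"
              using elim(2) by (simp add: M_def power2_eq_square powr_half_sqrt flip: powr_add)
            finally have "divisor_sigma m < q" using qN by linarith
            with qN mq * n show False by blast
          qed
        qed
        then have "card ?A \<le> card (?B \<union> ?C \<union> ?D \<union> ?E)" by (intro card_mono) auto
        also have "\<dots> \<le> card ?B + card ?C + card ?D + card ?E"
          by (intro order_trans[OF card_Un_le] add_mono order_refl)
        finally have "real (card ?A) \<le> real (card ?B) + real (card ?C) + real (card ?D) + real (card ?E)"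
          by linarith
        also have "\<dots> \<le> real N / L + 5 * real N / L + C1 * real N / L + (real N / L + real N * (C2 / L))"
        proof (intro add_mono)
          show "real (card ?B) \<le> real N / L" using L by simp
          show "real (card ?C) \<le> 5 * real N / L" using elim(1,5) by (simp add: L_def)
          show "real (card ?D) \<le> C1 * real N / L" unfolding L_def by (rule C1(2)[OF elim(2)])
          have "real (card ?E) \<le> real N / L ^ 8 + real N *
              (\<Sum>m | m \<in> {1..N} \<and> M < real m. real (gcd m (divisor_sigma m)) / (real m)\<^sup>2)"
            using L by (intro card_large_cofactor_le) simp
          also have "\<dots> \<le> real N / L + real N * (C2 / L)"
            unfolding L_def M_def using C2(2)[OF elim(3)] elim(4) by (intro add_mono mult_left_mono) auto
          finally show "real (card ?E) \<le> real N / L + real N * (C2 / L)" .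
        qed
        \<comment> \<open>The 7 collects 1 from \<open>?B\<close>, 5 from \<open>?C\<close> and 1
          from \<open>?E\<close>.\<close>
        also have "\<dots> = (7 + C1 + C2) * real N / L"
          by (simp add: add_divide_distrib distrib_left mult.commute)
        finally show "real (card ?A) \<le> (7 + C1 + C2) * real N / ln (real N) ^ 1"
          by (simp add: L_def)
      qed
    qed
  qed
qed

section \<open>From integers \<open>N\<close> to real \<open>x\<close>\<close>

theorem theorem1p5:
  shows "\<exists>K::real. \<forall>a::int. \<forall>x::real. x \<ge> 2 \<longrightarrow>
           real (card {n::nat. 0 < n \<and> real n \<le> x \<and> [int (divisor_sigma n) = a] (mod int n)})
             \<le> K * x / ln x"
proof -
  obtain C where C: "C > 0" "\<And>a N. N \<ge> 2 \<Longrightarrow>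
      real (card {n\<in>{1..N}. [int (divisor_sigma n) = a] (mod int n)}) \<le> C * real N / ln (real N)"
    using card_divisor_sigma_cong_bound by auto
  show ?thesis
  proof (intro exI[of _ "2 * C"] allI impI)
    fix a :: int and x :: real
    assume x: "x \<ge> 2"
    define N where "N = nat \<lfloor>x\<rfloor>"
    have "N \<ge> 2" using x by (simp add: N_def le_nat_iff le_floor_iff)
    have Nx: "real N \<le> x" "x \<le> real N + 1" using x unfolding N_def by linarith+
    have "{n::nat. 0 < n \<and> real n \<le> x \<and> [int (divisor_sigma n) = a] (mod int n)}
            = {n\<in>{1..N}. [int (divisor_sigma n) = a] (mod int n)}"
      using x by (auto simp: N_def le_nat_iff le_floor_iff)
    then have "real (card {n::nat. 0 < n \<and> real n \<le> x \<and> [int (divisor_sigma n) = a] (mod int n)})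
            \<le> C * real N / ln (real N)"
      using C(2)[OF \<open>N \<ge> 2\<close>, of a] by simp
    also have "\<dots> \<le> C * x / (ln x / 2)"
    proof (rule frac_le)
      show "C * real N \<le> C * x" using C Nx by simp
      \<comment> \<open>For \<open>N \<ge> 2\<close> one has x \<le> N + 1 \<le> N^2, so ln x \<le>
        2 ln N; this doubles the constant.\<close>
      have "2 * real N \<le> real N * real N" using \<open>N \<ge> 2\<close> by (intro mult_right_mono) auto
      moreover have "real N \<ge> 2" using \<open>N \<ge> 2\<close> by simp
      ultimately have "x \<le> (real N)\<^sup>2" using Nx unfolding power2_eq_square by linarith
      then have "ln x \<le> ln ((real N)\<^sup>2)" using x by (subst ln_le_cancel_iff) (use \<open>N \<ge> 2\<close> in auto)
      also have "\<dots> = 2 * ln (real N)" using \<open>N \<ge> 2\<close> by (simp add: ln_realpow)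
      finally show "ln x / 2 \<le> ln (real N)" by simp
    qed (use C x in auto)
    finally show "real (card {n::nat. 0 < n \<and> real n \<le> x \<and> [int (divisor_sigma n) = a] (mod int n)})
            \<le> 2 * C * x / ln x"
      by (simp add: mult_ac)
  qed
qed

end
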